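(* If $v\colon Y\to\widehat Y$ is a deformation retraction, then $\mathrm{TC}(vf)=\mathrm{TC}(f)$ for every fibration $f\colon X\to Y$, where $vf=v\circ f\colon X\to\widehat Y$.
   Context: All spaces are path-connected metric absolute neighbourhood retracts, and maps whose topological complexity is considered are continuous surjections. "Fibration" means Hurewicz fibration. A deformation retraction $v\colon Y\to\widehat Y$ onto a subspace $i\colon\widehat Y\hookrightarrow Y$ is a continuous map with $vi=1_{\widehat Y}$ and $iv\simeq 1_{Y}$. Let $I=[0,1]$ and let $X^I$ be the space of continuous paths in $X$ with the compact-open topology. For a continuous surjection $p\colon E\to B$, the sectional number $\mathrm{sec}(p)$ is the minimal integer $n$ for which there is an increasing sequence of open subsets $\emptyset=U_0\subseteq U_1\subseteq\cdots\subseteq U_n=B$ such that for each $i=1,\dots,n$ there is a continuous map $s\colon U_i-U_{i-1}\to E$ with $p(s(b))=b$ for all $b$; if no such $n$ exists, $\mathrm{sec}(p)=\infty$. For a continuous surjection $f\colon X\to Y$ between path-connected spaces, $\mathrm{TC}(f)=\mathrm{sec}(\pi_f)$, where $\pi_f\colon X^I\to X\times Y$, $\pi_f(\alpha)=(\alpha(0),f(\alpha(1)))$. *)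

theory Defs
  imports "HOL-Analysis.Analysis" "HOL-Library.Extended_Nat"
begin

abbreviation unit_interval :: "real topology" where
  "unit_interval \<equiv> top_of_set {0..1}"

text \<open>
  Absolute neighbourhood retracts in the class of metrizable spaces: whenever \<open>X\<close> is embedded as a
  closed subset of a metrizable space \<open>Z\<close>, it is a retract of an open neighbourhood in \<open>Z\<close>.
  HOL cannot quantify over spaces \<open>Z\<close> of all types. The type \<open>'a \<Rightarrow> real\<close> loses no generality: it
  contains the bounded functions on \<open>X\<close>, in which \<open>X\<close> embeds isometrically as a closed subset of its
  convex hull \<open>C\<close> (Kuratowski--Wojdyslawski). By Dugundji's extension theorem, a closed embedding of
  \<open>X\<close> into any metrizable space extends the identity of \<open>X\<close> to a map into \<open>C\<close>, along which a
  neighbourhood retraction in \<open>C\<close> can be pulled back. The library's \<open>ANR\<close> instead tests only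
  subsets of the type \<open>'a \<times> real\<close> with its type-class topology, which is adequate for Euclidean
  spaces only.
\<close>
definition ANR_space :: "'a topology \<Rightarrow> bool" where
  "ANR_space X \<longleftrightarrow> metrizable_space X \<and>
     (\<forall>(Z :: ('a \<Rightarrow> real) topology) h.
        metrizable_space Z \<and> embedding_map X Z h \<and> closedin Z (h ` topspace X) \<longrightarrow>
        (\<exists>W. openin Z W \<and> h ` topspace X \<subseteq> W \<and>
             (h ` topspace X) retract_of_space (subtopology Z W)))"

text \<open>
  Maps are required to be \<open>extensional\<close>, so that two elements are equal iff they agree on the domain.
  Taking \<open>K = {}\<close> in the subbase shows that the carrier consists of all continuous maps.
\<close>
definition compact_open_topology :: "'a topology \<Rightarrow> 'b topology \<Rightarrow> ('a \<Rightarrow> 'b) topology" where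
  "compact_open_topology A B = topology_generated_by
     {{g \<in> extensional (topspace A). continuous_map A B g \<and> g ` K \<subseteq> U} | K U.
        compactin A K \<and> openin B U}"

definition path_space :: "'a topology \<Rightarrow> (real \<Rightarrow> 'a) topology" where
  "path_space X = compact_open_topology unit_interval X"

text \<open>
  The homotopy lifting property with respect to all spaces \<open>Z\<close>. The type \<open>'a \<times> (real \<Rightarrow> 'b)\<close> of the
  test spaces loses no generality: it contains the mapping path space
  \<open>{(x, \<gamma>). x \<in> X \<and> \<gamma> \<in> Y\<^sup>I \<and> \<gamma> 0 = f x}\<close>, through which every homotopy lifting problem
  for \<open>f\<close> factors, whatever the type of its test space.
\<close>
definition hurewicz_fibration :: "'a topology \<Rightarrow> 'b topology \<Rightarrow> ('a \<Rightarrow> 'b) \<Rightarrow> bool" where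
  "hurewicz_fibration X Y f \<longleftrightarrow> continuous_map X Y f \<and>
     (\<forall>(Z :: ('a \<times> (real \<Rightarrow> 'b)) topology) g H.
        continuous_map Z X g \<and> continuous_map (prod_topology unit_interval Z) Y H \<and>
        (\<forall>z \<in> topspace Z. H (0, z) = f (g z)) \<longrightarrow>
        (\<exists>G. continuous_map (prod_topology unit_interval Z) X G \<and>
             (\<forall>z \<in> topspace Z. G (0, z) = g z) \<and>
             (\<forall>t \<in> {0..1}. \<forall>z \<in> topspace Z. f (G (t, z)) = H (t, z))))"

definition deformation_retraction :: "'a topology \<Rightarrow> 'a set \<Rightarrow> ('a \<Rightarrow> 'a) \<Rightarrow> bool" where
  "deformation_retraction Y S v \<longleftrightarrow> S \<subseteq> topspace Y \<and>
     retraction_maps Y (subtopology Y S) v id \<and>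
     homotopic_with (\<lambda>_. True) Y Y (id \<circ> v) id"

text \<open>The infimum of the empty set in \<^typ>\<open>enat\<close> is \<open>\<infinity>\<close>.\<close>
definition sectional_number :: "'e topology \<Rightarrow> 'b topology \<Rightarrow> ('e \<Rightarrow> 'b) \<Rightarrow> enat" where
  "sectional_number E B p = Inf (enat ` {n. \<exists>U :: nat \<Rightarrow> 'b set.
     U 0 = {} \<and> U n = topspace B \<and>
     (\<forall>i \<le> n. openin B (U i)) \<and>
     (\<forall>i \<in> {1..n}. U (i - 1) \<subseteq> U i \<and>
        (\<exists>s. continuous_map (subtopology B (U i - U (i - 1))) E s \<and>
             (\<forall>b \<in> U i - U (i - 1). p (s b) = b)))})"

definition TC :: "'a topology \<Rightarrow> 'b topology \<Rightarrow> ('a \<Rightarrow> 'b) \<Rightarrow> enat" where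
  "TC X Y f = sectional_number (path_space X) (prod_topology X Y) (\<lambda>\<alpha>. (\<alpha> 0, f (\<alpha> 1)))"

end

theory Submission
  imports Defs
begin

text \<open>
  Both inequalities pull a filtration back along a continuous map of the bases. Restricting along
  the inclusion \<open>X \<times> Yhat \<rightarrow> X \<times> Y\<close> turns local sections for \<open>f\<close> into local sections for \<open>v \<circ> f\<close>.
  Conversely, pull back along \<open>1 \<times> v\<close>: over \<open>(x, y)\<close> we get a path from \<open>x\<close> to a point \<open>x'\<close> with
  \<open>v (f x') = v y\<close>. The homotopy \<open>h\<close> from \<open>v\<close> to the identity gives a path from \<open>f x'\<close> through
  \<open>v (f x') = v y\<close> to \<open>y\<close>; the lift of this path starting at \<open>x'\<close> corrects the endpoint.
\<close>

section \<open>Exponential law for the compact-open topology\<close>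

lemma topspace_compact_open:
  "topspace (compact_open_topology A B) = {g \<in> extensional (topspace A). continuous_map A B g}"
    (is "_ = ?C")
proof -
  have "?C = {g \<in> extensional (topspace A). continuous_map A B g \<and> g ` {} \<subseteq> {}}"
    by simp
  then have "?C \<in> {{g \<in> extensional (topspace A). continuous_map A B g \<and> g ` K \<subseteq> U} | K U.
      compactin A K \<and> openin B U}"
    using compactin_empty openin_empty by blast
  then show ?thesis
    unfolding compact_open_topology_def topology_generated_by_topspace by blast
qed

text \<open>Half of the exponential law, valid for every \<open>A\<close>. It is the tube lemma:
  projecting along a compact \<open>K\<close> is a closed map, so the parameters whose slice sends
  some point of \<open>K\<close> outside \<open>U\<close> form a closed set.\<close>

lemma continuous_map_curry:
  assumes F: "continuous_map (prod_topology A Z) B F"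
  shows "continuous_map Z (compact_open_topology A B) (\<lambda>z. \<lambda>a\<in>topspace A. F (a, z))"
proof -
  have slice: "continuous_map A B (\<lambda>a\<in>topspace A. F (a, z))" if "z \<in> topspace Z" for z
  proof (rule continuous_map_eq)
    show "continuous_map A B (F \<circ> (\<lambda>a. (a, z)))"
      using that by (intro continuous_map_compose[OF _ F]) (auto intro!: continuous_intros)
  qed auto
  show ?thesis
    unfolding compact_open_topology_def
  proof (rule continuous_on_generated_topo)
    show "(\<lambda>z. \<lambda>a\<in>topspace A. F (a, z)) ` topspace Z \<subseteq> \<Union> {{g \<in> extensional (topspace A).
      continuous_map A B g \<and> g ` K \<subseteq> U} |K U. compactin A K \<and> openin B U}"
      using slice
      unfolding topspace_compact_open[unfolded compact_open_topology_def topology_generated_by_topspace]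
      by auto
  next
    fix V assume "V \<in> {{g \<in> extensional (topspace A). continuous_map A B g \<and> g ` K \<subseteq> U} |K U.
      compactin A K \<and> openin B U}"
    then obtain K U where V: "V = {g \<in> extensional (topspace A). continuous_map A B g \<and> g ` K \<subseteq> U}"
      and K: "compactin A K" and U: "openin B U" by blast
    have KA: "K \<subseteq> topspace A" using K by (rule compactin_subset_topspace)
    define P where "P = prod_topology (subtopology A K) Z"
    have FP: "continuous_map P B F"
      unfolding P_def prod_topology_subtopology(1) by (rule continuous_map_from_subtopology[OF F])
    have "closedin P {p \<in> topspace P. F p \<in> topspace B - U}"
      by (rule closedin_continuous_map_preimage[OF FP]) (use U in auto)
    moreover have "closed_map P Z snd"
      unfolding P_def using K by (intro Abstract_Topological_Spaces.closed_map_snd)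
        (simp add: compact_space_subtopology)
    ultimately have "closedin Z (snd ` {p \<in> topspace P. F p \<in> topspace B - U})"
      by (simp add: closed_map_def)
    then have "openin Z (topspace Z - snd ` {p \<in> topspace P. F p \<in> topspace B - U})"
      by blast
    \<comment> \<open>Slices are automatically continuous and extensional, so a parameter misses
      \<open>V\<close> exactly when its slice leaves \<open>U\<close> somewhere on
      \<open>K\<close>.\<close>
    also have "topspace Z - snd ` {p \<in> topspace P. F p \<in> topspace B - U} =
        (\<lambda>z. \<lambda>a\<in>topspace A. F (a, z)) -` V \<inter> topspace Z"
    proof -
      have "F (a, z) \<in> topspace B" if "a \<in> topspace A" "z \<in> topspace Z" for a z
        using continuous_map_funspace[OF F] that by auto
      then show ?thesis
        using KA slice by (fastforce simp: V P_def image_iff)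
    qed
    finally show "openin Z ((\<lambda>z. \<lambda>a\<in>topspace A. F (a, z)) -` V \<inter> topspace Z)" .
  qed
qed

text \<open>The converse half needs small compact neighbourhoods in \<open>A\<close>: a compact
  \<open>K\<close> around \<open>a\<close> that \<open>s z\<close> maps into \<open>U\<close>
  determines a subbasic open set of maps containing \<open>s z\<close>, and this controls all nearby
  parameters on \<open>K\<close> at once.\<close>

lemma continuous_map_uncurry:
  assumes s: "continuous_map Z (compact_open_topology A B) s"
    and lc: "locally_compact_space A" and "Hausdorff_space A"
  shows "continuous_map (prod_topology A Z) B (\<lambda>(a, z). s z a)"
proof -
  have sz: "continuous_map A B (s z)" if "z \<in> topspace Z" for z
    using continuous_map_funspace[OF s] that by (auto simp: topspace_compact_open)
  have base: "neighbourhood_base_of (compactin A) A"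
    using locally_compact_space_neighbourhood_base assms by blast
  show ?thesis
    unfolding continuous_map_def
  proof (intro conjI allI impI)
    show "(\<lambda>(a, z). s z a) \<in> topspace (prod_topology A Z) \<rightarrow> topspace B"
      using continuous_map_funspace[OF sz] by fastforce
  next
    fix U assume U: "openin B U"
    show "openin (prod_topology A Z) {x \<in> topspace (prod_topology A Z). (case x of (a, z) \<Rightarrow> s z a) \<in> U}"
      unfolding openin_prod_topology_alt
    proof (intro allI impI)
      fix a z assume "(a, z) \<in> {x \<in> topspace (prod_topology A Z). (case x of (a, z) \<Rightarrow> s z a) \<in> U}"
      then have az: "a \<in> topspace A" "z \<in> topspace Z" "s z a \<in> U" by auto
      have "openin A {a \<in> topspace A. s z a \<in> U}"
        using openin_continuous_map_preimage[OF sz U] az by blast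
      then obtain N K where N: "openin A N" "compactin A K" "a \<in> N" "N \<subseteq> K"
        and K: "K \<subseteq> {a \<in> topspace A. s z a \<in> U}"
        using base az unfolding neighbourhood_base_of by (smt (verit) mem_Collect_eq)
      define V where "V = {g \<in> extensional (topspace A). continuous_map A B g \<and> g ` K \<subseteq> U}"
      have V: "openin (compact_open_topology A B) V"
        unfolding compact_open_topology_def V_def
        by (rule topology_generated_by_Basis) (use N U in blast)
      have "s z \<in> V"
        using continuous_map_funspace[OF s] az K by (auto simp: V_def topspace_compact_open)
      moreover have "N \<times> {z \<in> topspace Z. s z \<in> V} \<subseteq>
          {x \<in> topspace (prod_topology A Z). (case x of (a, z) \<Rightarrow> s z a) \<in> U}"
        using N K by (auto simp: V_def)
      ultimately show "\<exists>N M. openin A N \<and> openin Z M \<and> a \<in> N \<and> z \<in> M \<and> N \<times> M \<subseteq>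
          {x \<in> topspace (prod_topology A Z). (case x of (a, z) \<Rightarrow> s z a) \<in> U}"
        using N az openin_continuous_map_preimage[OF s V] by blast
    qed
  qed
qed

section \<open>Homotopies\<close>

lemma continuous_map_concat_homotopies:
  assumes F: "continuous_map (prod_topology unit_interval Z) X F"
    and G: "continuous_map (prod_topology unit_interval Z) X G"
    and FG: "\<And>z. z \<in> topspace Z \<Longrightarrow> F (1, z) = G (0, z)"
  shows "continuous_map (prod_topology unit_interval Z) X
    (\<lambda>(t, z). if t \<le> 1/2 then F (2 * t, z) else G (2 * t - 1, z))"
proof -
  let ?P = "prod_topology unit_interval Z"
  have t: "continuous_map ?P unit_interval (k \<circ> fst)"
    if "continuous_on {0..1} k" "k ` {0..1} \<subseteq> {0..1}" for k :: "real \<Rightarrow> real"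
    using that by (intro continuous_map_compose[OF continuous_map_fst])
      (auto simp: continuous_map_in_subtopology)
  \<comment> \<open>Clamping the time to the unit interval makes both halves continuous on the whole
    product, as gluing along \<open>t = 1/2\<close> requires; the clamps are inactive on the half
    where each map is used.\<close>
  have min: "continuous_map ?P X (F \<circ> (\<lambda>p. ((\<lambda>t. min 1 (2 * t)) (fst p), snd p)))"
    by (intro continuous_map_compose[OF _ F] continuous_map_pairedI continuous_map_snd
        t[unfolded o_def] continuous_intros) auto
  have max: "continuous_map ?P X (G \<circ> (\<lambda>p. ((\<lambda>t. max 0 (2 * t - 1)) (fst p), snd p)))"
    by (intro continuous_map_compose[OF _ G] continuous_map_pairedI continuous_map_snd
        t[unfolded o_def] continuous_intros) auto
  have fst: "continuous_map ?P euclideanreal fst"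
    using continuous_map_fst continuous_map_into_fulltopology by blast
  have "continuous_map ?P X (\<lambda>p. if fst p \<le> 1/2
      then (F \<circ> (\<lambda>p. (min 1 (2 * fst p), snd p))) p
      else (G \<circ> (\<lambda>p. (max 0 (2 * fst p - 1), snd p))) p)"
    using min max fst FG
    by (intro continuous_map_cases_le continuous_map_from_subtopology) (auto simp: o_def)
  then show ?thesis
    by (rule continuous_map_eq) (auto simp: min_absorb2 max_absorb2)
qed

text \<open>The definition of a fibration quantifies over test spaces of one fixed type. An
  injection \<open>j\<close> into that type replaces \<open>Z\<close> by a homeomorphic copy, and
  the lift obtained there is carried back.\<close>

lemma hurewicz_fibration_lift:
  fixes X :: "'a topology" and Y :: "'b topology" and Z :: "'c topology"
    and j :: "'c \<Rightarrow> 'a \<times> (real \<Rightarrow> 'b)"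
  assumes f: "hurewicz_fibration X Y f" and j: "inj_on j (topspace Z)"
    and g: "continuous_map Z X g"
    and H: "continuous_map (prod_topology unit_interval Z) Y H"
    and Hg: "\<And>z. z \<in> topspace Z \<Longrightarrow> H (0, z) = f (g z)"
  obtains G where "continuous_map (prod_topology unit_interval Z) X G"
    and "\<And>z. z \<in> topspace Z \<Longrightarrow> G (0, z) = g z"
    and "\<And>t z. t \<in> {0..1} \<Longrightarrow> z \<in> topspace Z \<Longrightarrow> f (G (t, z)) = H (t, z)"
proof -
  define k where "k = inv_into (topspace Z) j"
  \<comment> \<open>Pulling the topology back along the inverse \<open>k\<close> turns
    \<open>j\<close> into a homeomorphism from \<open>Z\<close> onto \<open>Z'\<close>.\<close>
  define Z' where "Z' = pullback_topology (j ` topspace Z) k Z"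
  have kj: "k (j z) = z" if "z \<in> topspace Z" for z
    using j that by (simp add: k_def)
  have Z': "topspace Z' = j ` topspace Z"
    by (auto simp: Z'_def topspace_pullback_topology kj)
  have k: "continuous_map Z' Z k"
    using continuous_map_pullback[OF continuous_map_id[of Z]] by (simp add: Z'_def)
  have "continuous_map Z Z (k \<circ> j)"
    by (rule continuous_map_eq[OF continuous_map_id]) (simp add: kj)
  then have jc: "continuous_map Z Z' j"
    unfolding Z'_def by (rule continuous_map_pullback') auto
  have pair: "continuous_map (prod_topology unit_interval S) (prod_topology unit_interval T)
      (\<lambda>p. (fst p, m (snd p)))" if "continuous_map S T m" for S T and m :: "'d \<Rightarrow> 'e"
    using continuous_map_compose[OF continuous_map_snd that]
    by (intro continuous_map_pairedI continuous_map_fst) (simp add: o_def)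
  have "continuous_map Z' X (g \<circ> k)"
    by (rule continuous_map_compose[OF k g])
  moreover have "continuous_map (prod_topology unit_interval Z') Y (H \<circ> (\<lambda>p. (fst p, k (snd p))))"
    by (rule continuous_map_compose[OF pair[OF k] H])
  moreover have "\<forall>z \<in> topspace Z'. (H \<circ> (\<lambda>p. (fst p, k (snd p)))) (0, z) = f ((g \<circ> k) z)"
    by (auto simp: Z' kj Hg)
  ultimately obtain G where G: "continuous_map (prod_topology unit_interval Z') X G"
    "\<forall>z \<in> topspace Z'. G (0, z) = (g \<circ> k) z"
    "\<forall>t \<in> {0..1}. \<forall>z \<in> topspace Z'. f (G (t, z)) = (H \<circ> (\<lambda>p. (fst p, k (snd p)))) (t, z)"
    using f[unfolded hurewicz_fibration_def, THEN conjunct2, rule_format,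
        of Z' "g \<circ> k" "H \<circ> (\<lambda>p. (fst p, k (snd p)))"] by blast
  show thesis
  proof (rule that)
    show "continuous_map (prod_topology unit_interval Z) X (G \<circ> (\<lambda>p. (fst p, j (snd p))))"
      by (rule continuous_map_compose[OF pair[OF jc] G(1)])
  qed (use G kj in \<open>auto simp: Z'\<close>)
qed

section \<open>Sectional numbers\<close>

text \<open>Isolates the local condition in \<open>sectional_number\<close>, so that comparing two
  sectional numbers reduces to transferring sections over single strata.\<close>

definition section_over :: "'e topology \<Rightarrow> 'b topology \<Rightarrow> ('e \<Rightarrow> 'b) \<Rightarrow> 'b set \<Rightarrow> bool" where
  "section_over E B p W \<longleftrightarrow>
     (\<exists>s. continuous_map (subtopology B W) E s \<and> (\<forall>b \<in> W. p (s b) = b))"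

text \<open>Preimages preserve inclusions, differences and openness, so every filtration of
  \<open>B\<close> pulls back to one of \<open>B'\<close> of the same length. The infimum for
  \<open>B'\<close> is thus taken over a larger set, which also covers the infinite case.\<close>

lemma sectional_number_le_pullback:
  assumes \<phi>: "continuous_map B' B \<phi>"
    and sec: "\<And>W. W \<subseteq> topspace B \<Longrightarrow> section_over E B p W \<Longrightarrow>
      section_over E' B' p' {b \<in> topspace B'. \<phi> b \<in> W}"
  shows "sectional_number E' B' p' \<le> sectional_number E B p"
  unfolding sectional_number_def section_over_def[symmetric]
proof (intro Inf_superset_mono image_mono subsetI CollectI)
  fix n assume "n \<in> {n. \<exists>U :: nat \<Rightarrow> _ set. U 0 = {} \<and> U n = topspace B \<and>
     (\<forall>i \<le> n. openin B (U i)) \<and>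
     (\<forall>i \<in> {1..n}. U (i - 1) \<subseteq> U i \<and> section_over E B p (U i - U (i - 1)))}"
  then obtain U :: "nat \<Rightarrow> _ set" where U: "U 0 = {}" "U n = topspace B"
      "\<forall>i \<le> n. openin B (U i)"
      "\<forall>i \<in> {1..n}. U (i - 1) \<subseteq> U i \<and> section_over E B p (U i - U (i - 1))"
    by blast
  define V where "V i = {b \<in> topspace B'. \<phi> b \<in> U i}" for i
  have "section_over E' B' p' (V i - V (i - 1))" if "i \<in> {1..n}" for i
  proof -
    have "V i - V (i - 1) = {b \<in> topspace B'. \<phi> b \<in> U i - U (i - 1)}"
      by (auto simp: V_def)
    moreover have "U i - U (i - 1) \<subseteq> topspace B"
      using U(3) that openin_subset by fastforce
    ultimately show ?thesis
      using sec[of "U i - U (i - 1)"] U(4) that by (metis (no_types))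
  qed
  moreover have "V n = topspace B'"
    using continuous_map_funspace[OF \<phi>] U(2) by (auto simp: V_def)
  moreover have "\<forall>i \<le> n. openin B' (V i)"
    using U(3) openin_continuous_map_preimage[OF \<phi>] by (auto simp: V_def)
  moreover have "V 0 = {}" "\<forall>i \<in> {1..n}. V (i - 1) \<subseteq> V i"
    using U by (auto simp: V_def)
  ultimately show "\<exists>U :: nat \<Rightarrow> _ set. U 0 = {} \<and> U n = topspace B' \<and>
     (\<forall>i \<le> n. openin B' (U i)) \<and>
     (\<forall>i \<in> {1..n}. U (i - 1) \<subseteq> U i \<and> section_over E' B' p' (U i - U (i - 1)))"
    by blast
qed

section \<open>The two inequalities for topological complexity\<close>

lemma TC_compose_retraction_le:
  assumes r: "retraction_maps Y (subtopology Y S) v id" and S: "S \<subseteq> topspace Y"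
  shows "TC X (subtopology Y S) (v \<circ> f) \<le> TC X Y f"
  unfolding TC_def
proof (rule sectional_number_le_pullback)
  let ?B' = "prod_topology X (subtopology Y S)"
  have B': "?B' = subtopology (prod_topology X Y) (topspace X \<times> S)"
    by (simp add: prod_topology_subtopology(2))
  show id: "continuous_map ?B' (prod_topology X Y) id"
    unfolding B' by (rule continuous_map_from_subtopology) simp
  fix W assume "section_over (path_space X) (prod_topology X Y) (\<lambda>\<alpha>. (\<alpha> 0, f (\<alpha> 1))) W"
  then obtain s where s: "continuous_map (subtopology (prod_topology X Y) W) (path_space X) s"
    and sW: "\<forall>b\<in>W. (s b 0, f (s b 1)) = b"
    unfolding section_over_def by blast
  let ?W' = "{b \<in> topspace ?B'. id b \<in> W}"
  have "continuous_map (subtopology ?B' ?W') (path_space X) s"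
    unfolding B' subtopology_subtopology
    by (rule continuous_map_from_subtopology_mono[OF s]) auto
  moreover have "(s b 0, (v \<circ> f) (s b 1)) = b" if "b \<in> ?W'" for b
  proof -
    \<comment> \<open>A section for \<open>f\<close> ends over \<open>snd b\<close>, which lies in
      \<open>S\<close> and is therefore fixed by \<open>v\<close>.\<close>
    have "snd b \<in> S" "b \<in> W" "snd b \<in> topspace Y" using that S by auto
    then have "v (snd b) = snd b"
      using r by (auto simp: retraction_maps_def)
    then show ?thesis
      using sW \<open>b \<in> W\<close> by (metis comp_apply fst_conv prod.collapse snd_conv)
  qed
  ultimately show "section_over (path_space X) ?B' (\<lambda>\<alpha>. (\<alpha> 0, (v \<circ> f) (\<alpha> 1))) ?W'"
    unfolding section_over_def by blast
qed

text \<open>The correcting path in \<open>Y\<close> is lifted in two stages, \<open>G\<close> and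
  \<open>G'\<close>, the second starting where the first ends. All choices depend continuously on
  the point of the stratum because the lifting property is applied with the stratum itself as test
  space.\<close>

lemma TC_le_compose_deformation_retraction:
  fixes X :: "'a topology" and Y :: "'b topology"
  assumes d: "deformation_retraction Y S v" and f: "hurewicz_fibration X Y f"
  shows "TC X Y f \<le> TC X (subtopology Y S) (v \<circ> f)"
  unfolding TC_def
proof (rule sectional_number_le_pullback)
  let ?I = unit_interval and ?B = "prod_topology X Y" and ?B' = "prod_topology X (subtopology Y S)"
  let ?\<phi> = "\<lambda>p. (fst p, v (snd p))"
  have fc: "continuous_map X Y f"
    using f by (simp add: hurewicz_fibration_def)
  have v: "continuous_map Y (subtopology Y S) v"
    using d by (simp add: deformation_retraction_def retraction_maps_def)
  obtain h where h: "continuous_map (prod_topology ?I Y) Y h"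
    and h0: "\<And>y. h (0, y) = v y" and h1: "\<And>y. h (1, y) = y"
    using d by (auto simp: deformation_retraction_def homotopic_with_def)
  show \<phi>: "continuous_map ?B ?B' ?\<phi>"
    using continuous_map_compose[OF continuous_map_snd v]
    by (intro continuous_map_pairedI continuous_map_fst) (simp add: o_def)
  fix W assume "section_over (path_space X) ?B' (\<lambda>\<alpha>. (\<alpha> 0, (v \<circ> f) (\<alpha> 1))) W"
  then obtain s where s: "continuous_map (subtopology ?B' W) (path_space X) s"
    and sW: "\<And>b. b \<in> W \<Longrightarrow> (s b 0, (v \<circ> f) (s b 1)) = b"
    unfolding section_over_def by blast
  define W' where "W' = {b \<in> topspace ?B. ?\<phi> b \<in> W}"
  define Z where "Z = subtopology ?B W'"
  have Z: "topspace Z = W'"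
    by (auto simp: Z_def W'_def)
  have \<phi>Z: "continuous_map Z (subtopology ?B' W) ?\<phi>"
    unfolding Z_def
    by (intro continuous_map_into_subtopology continuous_map_from_subtopology \<phi>)
      (auto simp: W'_def)
  have snd: "continuous_map Z Y snd"
    unfolding Z_def by (intro continuous_map_from_subtopology continuous_map_snd)
  have at: "continuous_map Z T (\<lambda>z. F (c, z))"
    if "continuous_map (prod_topology ?I Z) T F" "c \<in> {0..1}" for T and F :: "_ \<Rightarrow> 'd" and c :: real
  proof -
    have "continuous_map Z T (F \<circ> (\<lambda>z. (c, z)))"
      by (rule continuous_map_compose[OF _ that(1)])
        (use that(2) in \<open>auto intro!: continuous_intros simp: continuous_map_id[unfolded id_def]\<close>)
    then show ?thesis by (simp add: o_def)
  qed
  \<comment> \<open>The reparametrization \<open>k\<close> allows \<open>h\<close> to be run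
    backwards for the first lift and forwards for the second.\<close>
  have h_comp: "continuous_map (prod_topology ?I Z) Y (\<lambda>p. h (k (fst p), m (snd p)))"
    if "continuous_map Z Y m" "continuous_on {0..1} k" "k ` {0..1} \<subseteq> {0..1}" for m k
  proof -
    have "continuous_map ?I ?I k"
      using that by (auto simp: continuous_map_in_subtopology)
    then have "continuous_map (prod_topology ?I Z) Y (h \<circ> (\<lambda>p. ((k \<circ> fst) p, (m \<circ> snd) p)))"
      using that by (intro continuous_map_compose[OF _ h] continuous_map_pairedI
          continuous_map_compose[OF continuous_map_fst] continuous_map_compose[OF continuous_map_snd])
    then show ?thesis by (simp add: o_def)
  qed
  \<comment> \<open>The pulled-back section in adjoint form: over \<open>z = (x, y)\<close> it runs
    from \<open>x\<close> to a point \<open>x'\<close> with \<open>v (f x') = v y\<close>.\<close>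
  define a where "a = (\<lambda>(t, z). s (?\<phi> z) t)"
  have "locally_compact_space ?I"
    by (intro compact_imp_locally_compact_space) (simp add: compact_space_subtopology)
  moreover have "Hausdorff_space ?I"
    by (simp add: Hausdorff_space_subtopology)
  ultimately have a: "continuous_map (prod_topology ?I Z) X a"
    using continuous_map_uncurry[OF continuous_map_compose[OF \<phi>Z s, unfolded path_space_def]]
    by (simp add: a_def)
  have a0: "a (0, z) = fst z" and va1: "v (f (a (1, z))) = v (snd z)" if "z \<in> W'" for z
    using sW[of "?\<phi> z"] that by (auto simp: a_def W'_def)
  \<comment> \<open>Constant paths embed pairs of points into the type of the test spaces.\<close>
  have j: "inj_on (\<lambda>(x, y). (x, \<lambda>_ :: real. y)) (topspace Z)"
    by (auto simp: inj_on_def fun_eq_iff)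
  have a1: "continuous_map Z X (\<lambda>z. a (1, z))"
    by (rule at[OF a]) simp
  have fa1: "continuous_map Z Y (\<lambda>z. f (a (1, z)))"
    using continuous_map_compose[OF a1 fc] by (simp add: o_def)
  \<comment> \<open>First lift: \<open>h\<close> reversed leads from \<open>f x'\<close> to
    \<open>v (f x')\<close>, where \<open>x' = a (1, z)\<close>.\<close>
  obtain G where G: "continuous_map (prod_topology ?I Z) X G"
    and G0: "\<And>z. z \<in> topspace Z \<Longrightarrow> G (0, z) = a (1, z)"
    and fG: "\<And>t z. t \<in> {0..1} \<Longrightarrow> z \<in> topspace Z \<Longrightarrow>
      f (G (t, z)) = h (1 - fst (t, z), f (a (1, snd (t, z))))"
    by (rule hurewicz_fibration_lift[OF f j a1, of "\<lambda>p. h (1 - fst p, f (a (1, snd p)))"])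
      (auto simp: h1 intro!: h_comp[OF fa1] continuous_on_op_minus)
  have G1: "continuous_map Z X (\<lambda>z. G (1, z))"
    by (rule at[OF G]) simp
  \<comment> \<open>Second lift: \<open>G\<close> ends over \<open>v (f x') = v y\<close>, which is
    where \<open>h\<close> starts its path to \<open>y\<close>.\<close>
  obtain G' where G': "continuous_map (prod_topology ?I Z) X G'"
    and G'0: "\<And>z. z \<in> topspace Z \<Longrightarrow> G' (0, z) = G (1, z)"
    and fG': "\<And>t z. t \<in> {0..1} \<Longrightarrow> z \<in> topspace Z \<Longrightarrow>
      f (G' (t, z)) = h (fst (t, z), snd (snd (t, z)))"
    by (rule hurewicz_fibration_lift[OF f j G1, of "\<lambda>p. h (fst p, snd (snd p))"])
      (auto simp: h0 fG va1 Z intro!: h_comp[OF snd, of "\<lambda>t. t"])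
  define b where "b = (\<lambda>(t, z). if t \<le> 1/2 then G (2 * t, z) else G' (2 * t - 1, z))"
  define c where "c = (\<lambda>(t, z). if t \<le> 1/2 then a (2 * t, z) else b (2 * t - 1, z))"
  have b: "continuous_map (prod_topology ?I Z) X b"
    unfolding b_def by (rule continuous_map_concat_homotopies[OF G G']) (simp add: G'0)
  have c: "continuous_map (prod_topology ?I Z) X c"
    unfolding c_def by (rule continuous_map_concat_homotopies[OF a b]) (simp add: b_def G0)
  \<comment> \<open>Currying returns to the path space; the restriction to the unit interval
    supplies the extensionality of its elements.\<close>
  have "continuous_map Z (path_space X) (\<lambda>z. \<lambda>t\<in>{0..1}. c (t, z))"
    using continuous_map_curry[OF c] by (simp add: path_space_def)
  moreover have "c (0, z) = fst z" "f (c (1, z)) = snd z" if "z \<in> W'" for z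
    using that by (auto simp: c_def b_def a0 fG' h1 Z)
  ultimately show "section_over (path_space X) ?B (\<lambda>\<alpha>. (\<alpha> 0, f (\<alpha> 1))) {b \<in> topspace ?B. ?\<phi> b \<in> W}"
    unfolding section_over_def W'_def[symmetric] Z_def
    by (intro exI[of _ "\<lambda>z. \<lambda>t\<in>{0..1}. c (t, z)"]) auto
qed

theorem corollary3p15:
  fixes X :: "'a topology" and Y :: "'b topology" and Yhat :: "'b set"
    and v :: "'b \<Rightarrow> 'b" and f :: "'a \<Rightarrow> 'b"
  assumes "path_connected_space X" and "ANR_space X"
    and "path_connected_space Y" and "ANR_space Y"
    and "path_connected_space (subtopology Y Yhat)" and "ANR_space (subtopology Y Yhat)"
    and "deformation_retraction Y Yhat v"
    and "hurewicz_fibration X Y f"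
    and "f ` topspace X = topspace Y"
  shows "TC X (subtopology Y Yhat) (v \<circ> f) = TC X Y f"
proof (rule antisym)
  show "TC X (subtopology Y Yhat) (v \<circ> f) \<le> TC X Y f"
    using assms(7) by (intro TC_compose_retraction_le) (auto simp: deformation_retraction_def)
  show "TC X Y f \<le> TC X (subtopology Y Yhat) (v \<circ> f)"
    using assms(7,8) by (rule TC_le_compose_deformation_retraction)
qed

end
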